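(* Given a file of size $F>0$, the expected transfer time of the static policy for channel $i\in\mathcal{N}$ is $$\mathbb{E}[T(i,F)] = \Delta\left(\frac{k_i}{p_i} + \mathbf{1}_{\{\alpha_i>0\}}\frac{1-p_i}{p_i} + \alpha_i\right),$$ where $k_i = \lfloor F/(\Delta r_i)\rfloor$ and $\alpha_i = F/(\Delta r_i) - k_i\in[0,1)$.
   Context: Let $\mathcal{N}=\{1,\dots,N\}$ be a finite set of channels, $\Delta>0$ a fixed slot duration, and for each $i\in\mathcal{N}$ let $r_i>0$ (rate) and $p_i\in(0,1]$ (availability probability). For each $i$, $\{Y_i(k)\}_{k\ge 0}$ is an i.i.d. sequence of Bernoulli random variables with $P[Y_i(k)=1]=p_i$, and the sequences are independent over $i$. The state of channel $i$ at time $t\ge 0$ is $X_i(t)=Y_i(\lfloor t/\Delta\rfloor)$ ($1$ = available, $0$ = unavailable). The static policy for channel $i$ uses channel $i$ at all times; its transfer time for a file of size $F>0$ is $$T(i,F)=\min\left\{T\ge 0:\int_0^T r_iX_i(t)\,dt\ge F\right\}.$$ $\mathbf{1}_{\{\cdot\}}$ denotes the indicator. *)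

theory Defs
  imports "HOL-Probability.Probability"
begin

text \<open>State of a channel at time \<open>t \<ge> 0\<close>, where \<open>y k\<close> is its state during the slot
  \<open>[k\<Delta>, (k+1)\<Delta>)\<close>. Negative times do not occur below.\<close>

definition channel_state :: "real \<Rightarrow> (nat \<Rightarrow> real) \<Rightarrow> real \<Rightarrow> real" where
  "channel_state \<Delta> y t = y (nat \<lfloor>t / \<Delta>\<rfloor>)"

text \<open>The minimum exists as soon as some \<open>T\<close> satisfies the constraint. If none does, the value
  is an unspecified constant; for a channel with positive availability probability this
  concerns only a null set of sample paths.\<close>

definition transfer_time :: "real \<Rightarrow> real \<Rightarrow> real \<Rightarrow> (nat \<Rightarrow> real) \<Rightarrow> real" where
  "transfer_time \<Delta> rate F y =
     (LEAST T. 0 \<le> T \<and> F \<le> integral {0..T} (\<lambda>t. rate * channel_state \<Delta> y t))"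

end

theory Submission imports Defs begin

text \<open>Measured in units of what one available slot transfers, the file has size
  \<open>F / (\<Delta> r) = c + \<beta>\<close> with \<open>c\<close> a natural number and \<open>0 < \<beta> \<le> 1\<close>. Rounding in this way, instead of
  down as in \<open>k + \<alpha>\<close>, removes the case distinction: the transfer consumes exactly \<open>c\<close> full available
  slots and then a fraction \<open>\<beta> > 0\<close> of the next available one. Let \<open>\<tau>\<close> be the number of slots up to
  and including the \<open>(c + 1)\<close>-st available one. Then the transfer ends at time \<open>\<Delta> (\<tau> - 1 + \<beta>)\<close>
  (\<open>transfer_time_eq\<close>).

  It remains to find \<open>E \<tau>\<close>. Write \<open>S n\<close> for the number of available slots among the first \<open>n\<close>. Then
  \<open>\<tau> = (\<Sum>n. of_bool (S n \<le> c))\<close>, because slot \<open>n\<close> is still part of the waiting time exactly if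
  \<open>S n \<le> c\<close>. Counting only the available slots that are still waited for gives
  \<open>(\<Sum>m<n. of_bool (S m \<le> c) * Y m) = min (S n) (c + 1)\<close>, and since \<open>Y m\<close> is independent of \<open>S m\<close>,
  expectations turn this into \<open>p * (\<Sum>m<n. P (S m \<le> c)) = E (min (S n) (c + 1))\<close>, an instance of Wald's
  identity. The right-hand side is at most \<open>c + 1\<close>, so the probabilities are summable; by
  Borel and Cantelli \<open>S n\<close> then exceeds \<open>c\<close> almost surely, and the right-hand side tends to \<open>c + 1\<close>.
  Hence \<open>E \<tau> = (c + 1) / p\<close> (\<open>expectation_waiting_time\<close>), and the claimed formula is this value
  rewritten in terms of \<open>k\<close> and \<open>\<alpha>\<close>: \<open>c = k\<close> and \<open>\<beta> = \<alpha>\<close> if \<open>\<alpha> > 0\<close>, but \<open>c = k - 1\<close> and \<open>\<beta> = 1\<close> if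
  \<open>\<alpha> = 0\<close>.\<close>

section \<open>Counting successes in a binary sequence\<close>

lemma sum_01_Nats:
  fixes y :: "nat \<Rightarrow> real"
  assumes "\<And>n. y n \<in> {0, 1}"
  shows "(\<Sum>j<n. y j) \<in> \<nat>"
proof (induction n)
  case (Suc n)
  then show ?case
    using assms[of n] by (auto intro: Nats_add)
qed auto

lemma Nats_less_imp_add_one_le:
  fixes x :: real
  assumes "x \<in> \<nat>" "real c < x"
  shows "real c + 1 \<le> x"
  using assms by (auto elim!: Nats_cases)

text \<open>Once the count has passed \<open>c\<close> no further success is recorded, so the recorded number is capped
  at \<open>c + 1\<close>; it cannot jump over that value, as the steps have size at most 1.\<close>

lemma sum_waiting_successes_eq_min:
  fixes y :: "nat \<Rightarrow> real"
  assumes y: "\<And>n. y n \<in> {0, 1}"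
  shows "(\<Sum>m<n. of_bool ((\<Sum>j<m. y j) \<le> real c) * y m) = min (\<Sum>j<n. y j) (real c + 1)"
proof (induction n)
  case (Suc n)
  have "0 \<le> y n" "y n \<le> 1"
    using y[of n] by auto
  then show ?case
    using Suc Nats_less_imp_add_one_le[OF sum_01_Nats[of y n, OF y], of c]
    by (auto simp: min_def)
qed auto

lemma partial_sums_01_mono:
  fixes y :: "nat \<Rightarrow> real"
  assumes "\<And>n. y n \<in> {0, 1}" "m \<le> n"
  shows "(\<Sum>j<m. y j) \<le> (\<Sum>j<n. y j)"
proof (rule sum_mono2)
  show "0 \<le> y b" for b
    using assms(1)[of b] by auto
qed (use assms in auto)

lemma obtain_crossing_slot:
  fixes y :: "nat \<Rightarrow> real"
  assumes y: "\<And>n. y n \<in> {0, 1}" and crossed: "(\<Sum>j<n. y j) > real c"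
  obtains m where "(\<Sum>j<m. y j) = real c" "y m = 1"
proof -
  have "\<not> (\<Sum>j<0. y j) > real c"
    by simp
  from ex_least_nat_less[OF crossed this]
  obtain m where m: "(\<Sum>j<m. y j) \<le> real c" "(\<Sum>j<Suc m. y j) > real c"
    by (metis lessI linorder_not_less order.refl)
  have "y m = 1"
    using y[of m] m by auto
  moreover have "(\<Sum>j<m. y j) \<in> \<nat>"
    using sum_01_Nats[of y m, OF y] .
  ultimately have "(\<Sum>j<m. y j) = real c"
    using m by (auto elim!: Nats_cases)
  with \<open>y m = 1\<close> show thesis
    by (rule that[rotated])
qed

lemma suminf_waiting_eq:
  fixes y :: "nat \<Rightarrow> real"
  assumes y: "\<And>n. y n \<in> {0, 1}" and m: "(\<Sum>j<m. y j) = real c" "y m = 1"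
  shows "(\<Sum>n. of_bool ((\<Sum>j<n. y j) \<le> real c)) = real m + 1"
proof -
  have "(\<Sum>j<n. y j) \<le> real c \<longleftrightarrow> n \<le> m" for n
    using partial_sums_01_mono[of y n m, OF y] partial_sums_01_mono[of y "Suc m" n, OF y] m
    by (cases "n \<le> m") auto
  then have "(\<Sum>n. of_bool ((\<Sum>j<n. y j) \<le> real c) :: real) = (\<Sum>n\<in>{..m}. of_bool (n \<le> m))"
    by (subst suminf_finite[of "{..m}"]) auto
  then show ?thesis
    by simp
qed

section \<open>The transfer time of one sample path\<close>

context
  fixes \<Delta> rate :: real and y :: "nat \<Rightarrow> real"
  assumes \<Delta>: "\<Delta> > 0" and rate: "rate > 0" and y: "\<And>n. y n \<in> {0, 1}"
begin

lemma channel_state_nonneg: "0 \<le> rate * channel_state \<Delta> y t"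
  using y[of "nat \<lfloor>t / \<Delta>\<rfloor>"] rate by (auto simp: channel_state_def)

lemma channel_state_in_slot:
  assumes "real n * \<Delta> \<le> t" "t < (real n + 1) * \<Delta>"
  shows "channel_state \<Delta> y t = y n"
proof -
  have "\<lfloor>t / \<Delta>\<rfloor> = int n"
    using assms \<Delta> by (intro floor_unique) (auto simp: field_simps)
  then show ?thesis
    by (simp add: channel_state_def)
qed

lemma has_integral_within_slot:
  assumes "real n * \<Delta> \<le> T" "T \<le> (real n + 1) * \<Delta>"
  shows "((\<lambda>t. rate * channel_state \<Delta> y t) has_integral rate * y n * (T - real n * \<Delta>))
           {real n * \<Delta>..T}"
  \<comment> \<open>The point \<open>T\<close> is excluded because it may already belong to the next slot.\<close>
proof (rule has_integral_spike_finite[where S = "{T}" and f = "\<lambda>_. rate * y n"])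
  show "((\<lambda>_. rate * y n) has_integral rate * y n * (T - real n * \<Delta>)) {real n * \<Delta>..T}"
    using has_integral_const_real[of "rate * y n" "real n * \<Delta>" T] assms by (simp add: mult_ac)
qed (use assms channel_state_in_slot[of n] in auto)

lemma has_integral_full_slots:
  "((\<lambda>t. rate * channel_state \<Delta> y t) has_integral rate * \<Delta> * (\<Sum>j<n. y j)) {0..real n * \<Delta>}"
proof (induction n)
  case (Suc n)
  have "((\<lambda>t. rate * channel_state \<Delta> y t) has_integral
      rate * \<Delta> * (\<Sum>j<n. y j) + rate * y n * (real (Suc n) * \<Delta> - real n * \<Delta>)) {0..real (Suc n) * \<Delta>}"
    using \<Delta> Suc by (intro has_integral_combine[OF _ _ _ has_integral_within_slot])
      (auto simp: algebra_simps)
  then show ?case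
    by (simp add: algebra_simps)
qed auto

lemma has_integral_up_to:
  assumes "real n * \<Delta> \<le> T" "T \<le> (real n + 1) * \<Delta>"
  shows "((\<lambda>t. rate * channel_state \<Delta> y t) has_integral
           rate * (\<Delta> * (\<Sum>j<n. y j) + y n * (T - real n * \<Delta>))) {0..T}"
proof -
  have "((\<lambda>t. rate * channel_state \<Delta> y t) has_integral
      rate * \<Delta> * (\<Sum>j<n. y j) + rate * y n * (T - real n * \<Delta>)) {0..T}"
    using \<Delta> assms
    by (intro has_integral_combine[OF _ _ has_integral_full_slots has_integral_within_slot]) auto
  then show ?thesis
    by (simp add: algebra_simps)
qed

lemma integral_le_full_slots:
  assumes "T \<le> real n * \<Delta>"
  shows "integral {0..T} (\<lambda>t. rate * channel_state \<Delta> y t) \<le> rate * \<Delta> * (\<Sum>j<n. y j)"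
proof -
  note full = has_integral_full_slots[of n]
  have "integral {0..T} (\<lambda>t. rate * channel_state \<Delta> y t)
      \<le> integral {0..real n * \<Delta>} (\<lambda>t. rate * channel_state \<Delta> y t)"
    using assms channel_state_nonneg
    by (intro integral_subset_le integrable_on_subinterval[OF has_integral_integrable[OF full]]
        has_integral_integrable[OF full]) auto
  then show ?thesis
    by (simp only: integral_unique[OF full])
qed

text \<open>By the start of slot \<open>m\<close> exactly \<open>c\<close> units have been transferred, which is too little because
  \<open>\<beta> > 0\<close>; within slot \<open>m\<close> the amount then grows at the constant speed \<open>rate\<close>, and \<open>\<beta> \<le> 1\<close> ensures
  that the file is complete before that slot is over or just as it ends.\<close>

lemma transfer_time_eq:
  assumes m: "(\<Sum>j<m. y j) = real c" "y m = 1"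
    and \<beta>: "0 < \<beta>" "\<beta> \<le> 1" and F: "F = rate * \<Delta> * (real c + \<beta>)"
  shows "transfer_time \<Delta> rate F y = \<Delta> * (real m + \<beta>)"
  unfolding transfer_time_def
proof (rule Least_equality)
  have transferred: "integral {0..T} (\<lambda>t. rate * channel_state \<Delta> y t)
      = rate * (\<Delta> * real c + (T - real m * \<Delta>))"
    if "real m * \<Delta> \<le> T" "T \<le> (real m + 1) * \<Delta>" for T
    using integral_unique[OF has_integral_up_to[OF that]] m by simp
  have "\<Delta> * \<beta> \<le> \<Delta>"
    using \<Delta> \<beta> by simp
  with transferred[of "\<Delta> * (real m + \<beta>)"]
  show "0 \<le> \<Delta> * (real m + \<beta>)
      \<and> F \<le> integral {0..\<Delta> * (real m + \<beta>)} (\<lambda>t. rate * channel_state \<Delta> y t)"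
    using \<Delta> \<beta> F by (auto simp: algebra_simps)
  fix T
  assume T: "0 \<le> T \<and> F \<le> integral {0..T} (\<lambda>t. rate * channel_state \<Delta> y t)"
  show "\<Delta> * (real m + \<beta>) \<le> T"
  proof (rule ccontr)
    assume early: "\<not> \<Delta> * (real m + \<beta>) \<le> T"
    show False
    proof (cases "real m * \<Delta> \<le> T")
      case True
      have "F \<le> rate * (\<Delta> * real c + (T - real m * \<Delta>))"
        using T transferred[of T] True early \<open>\<Delta> * \<beta> \<le> \<Delta>\<close> by (auto simp: algebra_simps)
      then have "rate * (\<Delta> * (real m + \<beta>)) \<le> rate * T"
        using F by (simp add: algebra_simps)
      then show False
        using early rate by simp
    next
      case False
      then have "F \<le> rate * \<Delta> * real c"
        using T integral_le_full_slots[of T m] m by simp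
      moreover have "0 < rate * \<Delta> * \<beta>"
        using \<Delta> rate \<beta> by simp
      ultimately show False
        using F by (simp add: algebra_simps)
    qed
  qed
qed

text \<open>If at most \<open>c\<close> slots are ever available, the transfer never ends, and the minimum is the default value
  of the empty condition. This value does not depend on the path, which makes the transfer time
  measurable on all of the sample space, not only up to a null set.\<close>

lemma transfer_time_never:
  assumes never: "\<And>n. (\<Sum>j<n. y j) \<le> real c"
    and \<beta>: "0 < \<beta>" and F: "F = rate * \<Delta> * (real c + \<beta>)"
  shows "transfer_time \<Delta> rate F y = (LEAST T. False)"
proof -
  have "integral {0..T} (\<lambda>t. rate * channel_state \<Delta> y t) < F" for T
  proof -
    obtain n where "T \<le> real n * \<Delta>"
      using real_arch_simple[of "T / \<Delta>"] \<Delta> by (auto simp: field_simps)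
    then have "integral {0..T} (\<lambda>t. rate * channel_state \<Delta> y t) \<le> rate * \<Delta> * (\<Sum>j<n. y j)"
      by (rule integral_le_full_slots)
    also have "\<dots> \<le> rate * \<Delta> * real c"
      using never \<Delta> rate by (intro mult_left_mono) auto
    also have "\<dots> < F"
      using F \<Delta> rate \<beta> by simp
    finally show ?thesis .
  qed
  then have "\<not> F \<le> integral {0..T} (\<lambda>t. rate * channel_state \<Delta> y t)" for T
    by (simp add: not_le)
  then show ?thesis
    unfolding transfer_time_def by simp
qed

lemma transfer_time_eq_if:
  assumes \<beta>: "0 < \<beta>" "\<beta> \<le> 1" and F: "F = rate * \<Delta> * (real c + \<beta>)"
  shows "transfer_time \<Delta> rate F y =
    (if \<exists>n. (\<Sum>j<n. y j) > real c
     then \<Delta> * ((\<Sum>n. of_bool ((\<Sum>j<n. y j) \<le> real c)) - 1 + \<beta>) else (LEAST T. False))"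
proof (cases "\<exists>n. (\<Sum>j<n. y j) > real c")
  case True
  then obtain m where m: "(\<Sum>j<m. y j) = real c" "y m = 1"
    using obtain_crossing_slot[of y, OF y] by metis
  show ?thesis
    using True transfer_time_eq[OF m \<beta> F] suminf_waiting_eq[of y, OF y m] by simp
next
  case False
  then have "\<And>n. (\<Sum>j<n. y j) \<le> real c"
    by (simp add: not_less)
  from transfer_time_never[OF this \<beta>(1) F] show ?thesis
    using False by simp
qed

end

section \<open>The expected waiting time for the next success after the first c\<close>

context prob_space
begin

context
  fixes Z :: "nat \<Rightarrow> 'a \<Rightarrow> real" and p :: real and c :: nat
  assumes Z_measurable[measurable]: "\<And>n. Z n \<in> borel_measurable M"
    and Z_01: "\<And>n \<omega>. \<omega> \<in> space M \<Longrightarrow> Z n \<omega> \<in> {0, 1}"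
    and Z_indep: "\<And>n. indep_var borel (Z n) borel (\<lambda>\<omega>. \<Sum>j<n. Z j \<omega>)"
    and Z_expectation: "\<And>n. expectation (Z n) = p"
    and p_pos: "p > 0"
begin

lemma integrable_waiting: "integrable M (\<lambda>\<omega>. of_bool ((\<Sum>j<n. Z j \<omega>) \<le> real c) :: real)"
  by (rule integrable_const_bound[where B = 1]) auto

text \<open>Whether slot \<open>m\<close> still belongs to the waiting time is decided by the slots before it, so this
  event is independent of \<open>Z m\<close>. Both sides are the expected number of successes among the first
  \<open>n\<close> slots that fall into the waiting time.\<close>

lemma wald_identity:
  "p * (\<Sum>m<n. expectation (\<lambda>\<omega>. of_bool ((\<Sum>j<m. Z j \<omega>) \<le> real c)))
     = expectation (\<lambda>\<omega>. min (\<Sum>j<n. Z j \<omega>) (real c + 1))"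
proof -
  have Z_integrable: "integrable M (Z m)" for m
  proof (rule integrable_const_bound[where B = 1])
    show "AE \<omega> in M. norm (Z m \<omega>) \<le> 1"
      using Z_01[of _ m] by (intro AE_I2) force
  qed auto
  have indep: "indep_var borel (Z m) borel (\<lambda>\<omega>. of_bool ((\<Sum>j<m. Z j \<omega>) \<le> real c) :: real)" for m
  proof -
    have "indep_var borel ((\<lambda>x. x) \<circ> Z m) borel
        ((\<lambda>s. of_bool (s \<le> real c) :: real) \<circ> (\<lambda>\<omega>. \<Sum>j<m. Z j \<omega>))"
      using Z_indep[of m] by (rule indep_var_compose) auto
    then show ?thesis
      by (simp add: comp_def)
  qed
  have "expectation (\<lambda>\<omega>. min (\<Sum>j<n. Z j \<omega>) (real c + 1))
      = expectation (\<lambda>\<omega>. \<Sum>m<n. Z m \<omega> * of_bool ((\<Sum>j<m. Z j \<omega>) \<le> real c))"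
    using sum_waiting_successes_eq_min[of "\<lambda>n. Z n \<omega>" for \<omega>] Z_01
    by (intro Bochner_Integration.integral_cong) (auto simp: mult.commute)
  also have "\<dots> = (\<Sum>m<n. expectation (\<lambda>\<omega>. Z m \<omega> * of_bool ((\<Sum>j<m. Z j \<omega>) \<le> real c)))"
    by (intro Bochner_Integration.integral_sum indep_var_integrable[OF indep] Z_integrable
        integrable_waiting)
  also have "\<dots> = (\<Sum>m<n. p * expectation (\<lambda>\<omega>. of_bool ((\<Sum>j<m. Z j \<omega>) \<le> real c)))"
    using indep_var_lebesgue_integral[OF indep Z_integrable integrable_waiting] Z_expectation
    by simp
  finally show ?thesis
    by (simp add: sum_distrib_left)
qed

text \<open>By the identity the partial sums are at most \<open>(c + 1) / p\<close>. Summability comes before any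
  knowledge that the waiting time is finite; that is a consequence of it, through Borel and
  Cantelli.\<close>

lemma summable_expectation_waiting:
  "summable (\<lambda>n. expectation (\<lambda>\<omega>. of_bool ((\<Sum>j<n. Z j \<omega>) \<le> real c) :: real))"
proof (rule summableI_nonneg_bounded[where x = "(real c + 1) / p"])
  fix n
  have "p * (\<Sum>m<n. expectation (\<lambda>\<omega>. of_bool ((\<Sum>j<m. Z j \<omega>) \<le> real c))) \<le> real c + 1"
    unfolding wald_identity
  proof (rule integral_le_const)
    show "integrable M (\<lambda>\<omega>. min (\<Sum>j<n. Z j \<omega>) (real c + 1))"
    proof (rule integrable_const_bound[where B = "real c + 1"])
      have "0 \<le> (\<Sum>j<n. Z j \<omega>)" if "\<omega> \<in> space M" for \<omega>
        using partial_sums_01_mono[of "\<lambda>j. Z j \<omega>" 0 n] Z_01[OF that] by auto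
      then show "AE \<omega> in M. norm (min (\<Sum>j<n. Z j \<omega>) (real c + 1)) \<le> real c + 1"
        by (intro AE_I2) (auto simp: min_def)
    qed auto
  qed auto
  then show "(\<Sum>m<n. expectation (\<lambda>\<omega>. of_bool ((\<Sum>j<m. Z j \<omega>) \<le> real c))) \<le> (real c + 1) / p"
    using p_pos by (simp add: field_simps)
qed auto

lemma AE_eventually_crossed: "AE \<omega> in M. \<forall>\<^sub>F n in sequentially. (\<Sum>j<n. Z j \<omega>) > real c"
proof -
  define A where "A n = {\<omega> \<in> space M. (\<Sum>j<n. Z j \<omega>) \<le> real c}" for n
  have A[measurable]: "A n \<in> sets M" for n
    unfolding A_def by measurable
  have "prob (A n) = expectation (\<lambda>\<omega>. of_bool ((\<Sum>j<n. Z j \<omega>) \<le> real c))" for n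
  proof -
    have "prob (A n) = expectation (indicator (A n))"
      by simp
    also have "\<dots> = expectation (\<lambda>\<omega>. of_bool ((\<Sum>j<n. Z j \<omega>) \<le> real c))"
      by (intro Bochner_Integration.integral_cong) (auto simp: A_def indicator_def)
    finally show ?thesis .
  qed
  then have "AE \<omega> in M. \<forall>\<^sub>F n in sequentially. \<omega> \<in> space M - A n"
    using summable_expectation_waiting
    by (intro borel_cantelli_AE1) (auto simp: emeasure_eq_measure)
  then show ?thesis
    by (rule AE_mp) (auto intro!: AE_I2 elim!: eventually_mono simp: A_def)
qed

lemma expectation_waiting_sums:
  "(\<lambda>n. expectation (\<lambda>\<omega>. of_bool ((\<Sum>j<n. Z j \<omega>) \<le> real c) :: real)) sums ((real c + 1) / p)"
proof -
  have "(\<lambda>n. expectation (\<lambda>\<omega>. min (\<Sum>j<n. Z j \<omega>) (real c + 1))) \<longlonglongrightarrow> expectation (\<lambda>_. real c + 1)"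
  proof (rule integral_dominated_convergence[where w = "\<lambda>_. real c + 1"])
    show "AE \<omega> in M. (\<lambda>n. min (\<Sum>j<n. Z j \<omega>) (real c + 1)) \<longlonglongrightarrow> real c + 1"
      using AE_eventually_crossed
    proof (rule AE_mp, intro AE_I2 impI tendsto_eventually)
      fix \<omega> assume "\<omega> \<in> space M" "\<forall>\<^sub>F n in sequentially. (\<Sum>j<n. Z j \<omega>) > real c"
      then show "\<forall>\<^sub>F n in sequentially. min (\<Sum>j<n. Z j \<omega>) (real c + 1) = real c + 1"
        by (elim eventually_mono)
          (use Nats_less_imp_add_one_le[OF sum_01_Nats] Z_01 in \<open>auto simp: min_def antisym\<close>)
    qed
    show "AE \<omega> in M. norm (min (\<Sum>j<n. Z j \<omega>) (real c + 1)) \<le> real c + 1" for n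
    proof (rule AE_I2)
      fix \<omega> assume "\<omega> \<in> space M"
      then have "0 \<le> (\<Sum>j<n. Z j \<omega>)"
        using partial_sums_01_mono[of "\<lambda>j. Z j \<omega>" 0 n] Z_01 by auto
      then show "norm (min (\<Sum>j<n. Z j \<omega>) (real c + 1)) \<le> real c + 1"
        by (auto simp: min_def)
    qed
  qed auto
  then have "(\<lambda>n. p * (\<Sum>m<n. expectation (\<lambda>\<omega>. of_bool ((\<Sum>j<m. Z j \<omega>) \<le> real c)))) 
      \<longlonglongrightarrow> real c + 1"
    by (simp add: wald_identity prob_space)
  from tendsto_divide[OF this tendsto_const[of p]] p_pos show ?thesis
    by (simp add: sums_def)
qed

lemma
  shows integrable_waiting_time:
      "integrable M (\<lambda>\<omega>. \<Sum>n. of_bool ((\<Sum>j<n. Z j \<omega>) \<le> real c) :: real)"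
    and expectation_waiting_time:
      "expectation (\<lambda>\<omega>. \<Sum>n. of_bool ((\<Sum>j<n. Z j \<omega>) \<le> real c)) = (real c + 1) / p"
proof -
  have summable: "AE \<omega> in M. summable (\<lambda>n. norm (of_bool ((\<Sum>j<n. Z j \<omega>) \<le> real c) :: real))"
    using AE_eventually_crossed
  proof (rule AE_mp, intro AE_I2 impI)
    fix \<omega> assume "\<forall>\<^sub>F n in sequentially. (\<Sum>j<n. Z j \<omega>) > real c"
    then have "\<forall>\<^sub>F n in sequentially. norm (of_bool ((\<Sum>j<n. Z j \<omega>) \<le> real c) :: real) = 0"
      by eventually_elim auto
    then show "summable (\<lambda>n. norm (of_bool ((\<Sum>j<n. Z j \<omega>) \<le> real c) :: real))"
      by (subst summable_cong[where g = "\<lambda>_. 0"]) auto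
  qed
  have sums: "summable (\<lambda>n. expectation (\<lambda>\<omega>. norm (of_bool ((\<Sum>j<n. Z j \<omega>) \<le> real c) :: real)))"
    using summable_expectation_waiting by simp
  show "integrable M (\<lambda>\<omega>. \<Sum>n. of_bool ((\<Sum>j<n. Z j \<omega>) \<le> real c) :: real)"
    by (rule integrable_suminf[OF integrable_waiting summable sums])
  show "expectation (\<lambda>\<omega>. \<Sum>n. of_bool ((\<Sum>j<n. Z j \<omega>) \<le> real c)) = (real c + 1) / p"
    using integral_suminf[OF integrable_waiting summable sums]
      sums_unique[OF expectation_waiting_sums] by simp
qed

text \<open>Since \<open>M\<close> may be incomplete, almost sure equality with a measurable function does not by
  itself make the transfer time measurable; its value on the paths that never cross \<open>c\<close> matters
  as well.\<close>

lemma expectation_transfer_time: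
  assumes \<Delta>: "\<Delta> > 0" and rate: "rate > 0"
    and \<beta>: "0 < \<beta>" "\<beta> \<le> 1" and F: "F = rate * \<Delta> * (real c + \<beta>)"
  shows "integrable M (\<lambda>\<omega>. transfer_time \<Delta> rate F (\<lambda>n. Z n \<omega>))" (is ?int)
    and "expectation (\<lambda>\<omega>. transfer_time \<Delta> rate F (\<lambda>n. Z n \<omega>)) = \<Delta> * ((real c + 1) / p - 1 + \<beta>)"
      (is ?exp)
proof -
  let ?W = "\<lambda>\<omega>. \<Delta> * ((\<Sum>n. of_bool ((\<Sum>j<n. Z j \<omega>) \<le> real c)) - 1 + \<beta>)"
  have eq: "transfer_time \<Delta> rate F (\<lambda>n. Z n \<omega>) =
      (if \<exists>n. (\<Sum>j<n. Z j \<omega>) > real c then ?W \<omega> else (LEAST T. False))" if "\<omega> \<in> space M" for \<omega>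
    using transfer_time_eq_if[of \<Delta> rate "\<lambda>n. Z n \<omega>", OF \<Delta> rate Z_01[OF that] \<beta> F] .
  have [measurable]: "(\<lambda>\<omega>. transfer_time \<Delta> rate F (\<lambda>n. Z n \<omega>)) \<in> borel_measurable M"
    by (subst measurable_cong[OF eq]) measurable
  have AE_eq: "AE \<omega> in M. transfer_time \<Delta> rate F (\<lambda>n. Z n \<omega>) = ?W \<omega>"
    using AE_eventually_crossed
  proof (rule AE_mp, intro AE_I2 impI)
    fix \<omega> assume "\<omega> \<in> space M" "\<forall>\<^sub>F n in sequentially. (\<Sum>j<n. Z j \<omega>) > real c"
    then show "transfer_time \<Delta> rate F (\<lambda>n. Z n \<omega>) = ?W \<omega>"
      using eq eventually_happens'[OF sequentially_bot] by (metis (mono_tags, lifting))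
  qed
  have W: "integrable M ?W"
    using integrable_waiting_time by auto
  show ?int
    by (subst integrable_cong_AE[OF _ _ AE_eq]) (use W in auto)
  have "expectation (\<lambda>\<omega>. transfer_time \<Delta> rate F (\<lambda>n. Z n \<omega>)) = expectation ?W"
    by (rule integral_cong_AE[OF _ _ AE_eq]) (use W in auto)
  also have "\<dots> = \<Delta> * ((real c + 1) / p - 1 + \<beta>)"
    using integrable_waiting_time expectation_waiting_time by (simp add: prob_space)
  finally show ?exp .
qed

end

end

section \<open>The expected transfer time of the static policy\<close>

theorem proposition3p1:
  fixes M :: "'a measure"
    and N :: nat
    and \<Delta> F \<alpha> :: real
    and r p :: "nat \<Rightarrow> real"
    and Y :: "nat \<Rightarrow> nat \<Rightarrow> 'a \<Rightarrow> real"
    and i :: nat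
    and k :: int
  assumes "prob_space M"
    and "\<Delta> > 0"
    and "\<And>j. j \<in> {1..N} \<Longrightarrow> r j > 0"
    and "\<And>j. j \<in> {1..N} \<Longrightarrow> p j \<in> {0<..1}"
    and "\<And>j n \<omega>. j \<in> {1..N} \<Longrightarrow> \<omega> \<in> space M \<Longrightarrow> Y j n \<omega> \<in> {0, 1}"
    and "\<And>j n. j \<in> {1..N} \<Longrightarrow> measure M {\<omega> \<in> space M. Y j n \<omega> = 1} = p j"
    and "prob_space.indep_vars M (\<lambda>_. borel) (\<lambda>(j, n). Y j n) ({1..N} \<times> UNIV)"
    and "i \<in> {1..N}"
    and "F > 0"
    and "k = \<lfloor>F / (\<Delta> * r i)\<rfloor>"
    and "\<alpha> = F / (\<Delta> * r i) - of_int k"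
  shows "\<alpha> \<in> {0..<1}
    \<and> integrable M (\<lambda>\<omega>. transfer_time \<Delta> (r i) F (\<lambda>n. Y i n \<omega>))
    \<and> prob_space.expectation M (\<lambda>\<omega>. transfer_time \<Delta> (r i) F (\<lambda>n. Y i n \<omega>))
        = \<Delta> * (of_int k / p i + of_bool (\<alpha> > 0) * ((1 - p i) / p i) + \<alpha>)"
proof -
  interpret prob_space M by fact
  note i = \<open>i \<in> {1..N}\<close>
  have r: "r i > 0" and p: "p i > 0"
    using assms(3,4)[OF i] by auto
  have Y_01: "Y i n \<omega> \<in> {0, 1}" if "\<omega> \<in> space M" for n \<omega>
    using assms(5)[OF i that] .
  have Y_measurable[measurable]: "Y i n \<in> borel_measurable M" for n
    using assms(7) i by (auto simp: indep_vars_def2)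
  have Y_expectation: "expectation (Y i n) = p i" for n
  proof -
    have "expectation (Y i n) = expectation (indicator {\<omega> \<in> space M. Y i n \<omega> = 1})"
      using Y_01[of _ n] by (intro Bochner_Integration.integral_cong) (force simp: indicator_def)+
    then show ?thesis
      using assms(6)[OF i, of n] by simp
  qed
  have Y_indep: "indep_var borel (Y i n) borel (\<lambda>\<omega>. \<Sum>j<n. Y i j \<omega>)" for n
  proof -
    let ?past = "Pair i ` {..<n}"
    have "indep_vars (\<lambda>_. borel) (\<lambda>(j, n). Y j n) (insert (i, n) ?past)"
      using assms(7) i by (rule_tac indep_vars_subset) auto
    then have "indep_var borel ((\<lambda>(j, n). Y j n) (i, n)) borel
        (\<lambda>\<omega>. \<Sum>q\<in>?past. (\<lambda>(j, n). Y j n) q \<omega>)"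
      by (intro indep_vars_sum) auto
    then show ?thesis
      by (simp add: sum.reindex inj_on_def)
  qed

  define x where "x = F / (\<Delta> * r i)"
  have "x > 0"
    using \<open>F > 0\<close> \<open>\<Delta> > 0\<close> r by (simp add: x_def)
  have \<alpha>: "0 \<le> \<alpha>" "\<alpha> < 1"
    using assms(10,11) by linarith+
  \<comment> \<open>For \<open>\<alpha> = 0\<close> the last slot is used up completely, and \<open>k > 0\<close> because \<open>F > 0\<close>.\<close>
  define c where "c = nat (if \<alpha> > 0 then k else k - 1)"
  define \<beta> where "\<beta> = (if \<alpha> > 0 then \<alpha> else 1)"
  have k: "k \<ge> 0" "\<alpha> = 0 \<Longrightarrow> k \<ge> 1"
    using \<open>x > 0\<close> assms(10,11) unfolding x_def[symmetric] by (simp, linarith)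
  have c: "real c = (if \<alpha> > 0 then of_int k else of_int k - 1)"
    using k \<alpha> by (auto simp: c_def)
  have \<beta>: "0 < \<beta>" "\<beta> \<le> 1"
    using \<alpha> by (auto simp: \<beta>_def)
  have "x = real c + \<beta>"
    using assms(11) \<alpha> unfolding x_def[symmetric] c \<beta>_def by auto
  then have F: "F = r i * \<Delta> * (real c + \<beta>)"
    using \<open>\<Delta> > 0\<close> r by (simp add: x_def field_simps)
  note result = expectation_transfer_time[of "Y i" "p i" \<Delta> "r i" \<beta> F c,
      OF Y_measurable Y_01 Y_indep Y_expectation p \<open>\<Delta> > 0\<close> r \<beta> F]
  have "(real c + 1) / p i - 1 + \<beta> = of_int k / p i + of_bool (\<alpha> > 0) * ((1 - p i) / p i) + \<alpha>"
    using \<alpha> p by (auto simp: c \<beta>_def field_simps)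
  then show ?thesis
    using result \<alpha> by simp
qed

end
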